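(* Let $n,r$ be integers with $1<r<n$, and let $p\ge1$, $q_1>0$, $q_2>0$. Define $\rho(X)=\|X_-\|_{\ell_p}^{q_1}+\|X^{T}X-I_r\|_{\ell_p}^{q_2}$ for $X\in\mathbb{R}^{n\times r}$. There exists a Lipschitz continuous function $F:\mathbb{R}^{n\times r}\to\mathbb{R}$ such that the following statements hold. (a) $\operatorname{Argmin}\{F(X):X\in\mathbb{S}^{n,r}_+\}=\mathbb{S}^{n,r}_+$. (b) If $q_1>1/2$ or $q_2\ne1/2$, then every $X^*\in\mathbb{S}^{n,r}_+$ fails to be a global minimizer of $F+\mu\rho$ on $\mathbb{R}^{n\times r}$ for every $\mu>0$. (c) If $q_1>1/2$ or $q_2>1/2$, then there exists an $X^*\in\mathbb{S}^{n,r}_+$ that, for every $\mu>0$, is not a local minimizer of $F+\mu\rho$ on $\mathbb{R}^{n\times r}$.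
   Context: $\mathbb{S}^{n,r}_+=\{X\in\mathbb{R}^{n\times r}:X^{T}X=I_r,\ X\ge0\}$ (entry-wise inequality) is the nonnegative Stiefel manifold. For a matrix $Y$, $Y_-=\max\{-Y,0\}$ entry-wise. For $p\in[1,\infty)$, $\|\cdot\|_{\ell_p}$ is the entry-wise $\ell_p$-norm of a matrix. Lipschitz continuity is with respect to the Frobenius norm. $\operatorname{Argmin}$ denotes the set of global minimizers. *)

theory Defs
  imports "HOL-Analysis.Analysis"
begin

(* An n x r real matrix has type real ^ 'r ^ 'n, with n = CARD('n) rows and r = CARD('r) columns.
   The norm (hence the distance) of this type is the Euclidean norm of the vector of row norms,
   i.e. the Frobenius norm. *)

definition nonneg_stiefel :: "(real ^ 'r ^ 'n) set" where
  "nonneg_stiefel = {X. transpose X ** X = mat 1 \<and> (\<forall>i j. 0 \<le> X $ i $ j)}"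

definition neg_part :: "real ^ 'r ^ 'n \<Rightarrow> real ^ 'r ^ 'n" where
  "neg_part Y = (\<chi> i j. max (- (Y $ i $ j)) 0)"

definition entrywise_norm :: "real \<Rightarrow> real ^ 'r ^ 'n \<Rightarrow> real" where
  "entrywise_norm p Y = (\<Sum>i\<in>UNIV. \<Sum>j\<in>UNIV. \<bar>Y $ i $ j\<bar> powr p) powr (1 / p)"

definition penalty :: "real \<Rightarrow> real \<Rightarrow> real \<Rightarrow> real ^ 'r ^ 'n \<Rightarrow> real" where
  "penalty p q1 q2 X =
     entrywise_norm p (neg_part X) powr q1 + entrywise_norm p (transpose X ** X - mat 1) powr q2"

definition Argmin :: "('a \<Rightarrow> real) \<Rightarrow> 'a set \<Rightarrow> 'a set" where
  "Argmin f S = {x. is_arg_min f (\<lambda>y. y \<in> S) x}"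

definition local_minimizer :: "('a::metric_space \<Rightarrow> real) \<Rightarrow> 'a \<Rightarrow> bool" where
  "local_minimizer f x \<longleftrightarrow> (\<exists>e>0. x \<in> Argmin f (ball x e))"

end

theory Submission
  imports Defs
begin

text \<open>
  Write \<open>S\<close> for the nonnegative Stiefel manifold and take \<open>F Y = - infdist Y S\<close>.  This function is
  1-Lipschitz and vanishes on \<open>S\<close>, and so does the penalty.  Hence a point of \<open>S\<close> minimizes
  \<open>F + \<mu> * penalty\<close> on a neighbourhood exactly when the error bound
  \<open>infdist Y S \<le> \<mu> * penalty Y\<close> holds there, and everything reduces to violating this error bound
  for every \<open>\<mu>\<close>.

  Violations near \<open>S\<close> exist because two columns of an element of \<open>S\<close> have disjoint supports.  If a
  row of \<open>Y\<close> has two entries of order \<open>\<delta>\<close>, then \<open>Y\<close> is at distance of order \<open>\<delta>\<close> from \<open>S\<close>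
  (\<open>two_entries_infdist_lower\<close>).  However, these two entries contribute only \<open>\<delta>\<^sup>2\<close> to the inner
  product of the columns.  This defect can be left in place, so that only
  \<open>transpose Y ** Y - mat 1\<close> is nonzero, of order \<open>\<delta>\<^sup>2\<close>; or it can be cancelled by one negative
  entry of order \<open>\<delta>\<^sup>2\<close>, so that only \<open>neg_part Y\<close> is nonzero.  The penalty is then of order
  \<open>\<delta> powr (2 * q2)\<close> or \<open>\<delta> powr (2 * q1)\<close>, which is \<open>o(\<delta>)\<close> as soon as the exponent \<open>q2\<close> or \<open>q1\<close>
  exceeds \<open>1/2\<close>.  The spare row that carries the two small entries exists since there are more rows
  than columns.

  Violations far from \<open>S\<close> exist for \<open>q2 < 1/2\<close>: along a ray \<open>t *\<^sub>R X\<close> with \<open>X \<in> S\<close> the distance to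
  the bounded set \<open>S\<close> grows like \<open>t\<close>, but the penalty only like \<open>t powr (2 * q2)\<close>.
\<close>

section \<open>Bounds on the penalty\<close>

lemma gram_entry:
  fixes X :: "real ^ 'r ^ 'n"
  shows "(transpose X ** X) $ j $ l = (\<Sum>i\<in>UNIV. X $ i $ j * X $ i $ l)"
  by (simp add: matrix_matrix_mult_def transpose_def)

lemma entrywise_norm_le:
  fixes Y :: "real ^ 'r::finite ^ 'n::finite"
  assumes "1 \<le> p" and bound: "\<And>i j. \<bar>Y $ i $ j\<bar> \<le> m"
  shows "entrywise_norm p Y \<le> (real CARD('n) * real CARD('r)) powr (1 / p) * m"
proof -
  have m: "0 \<le> m" using bound[of undefined undefined] by linarith
  have "(\<Sum>i\<in>UNIV. \<Sum>j\<in>UNIV. \<bar>Y $ i $ j\<bar> powr p) \<le> (\<Sum>i\<in>(UNIV::'n set). \<Sum>j\<in>(UNIV::'r set). m powr p)"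
    using assms by (intro sum_mono powr_mono2) auto
  also have "\<dots> = (real CARD('n) * real CARD('r)) * m powr p" by simp
  finally have "entrywise_norm p Y \<le> ((real CARD('n) * real CARD('r)) * m powr p) powr (1 / p)"
    unfolding entrywise_norm_def using assms(1) by (intro powr_mono2) (auto intro!: sum_nonneg)
  also have "\<dots> = (real CARD('n) * real CARD('r)) powr (1 / p) * (m powr p) powr (1 / p)"
    by (intro powr_mult)
  also have "(m powr p) powr (1 / p) = m"
    using m assms(1) by (simp add: powr_powr)
  finally show ?thesis .
qed

lemma entrywise_norm_powr_le:
  fixes Y :: "real ^ 'r::finite ^ 'n::finite"
  assumes "1 \<le> p" "0 < q" and bound: "\<And>i j. \<bar>Y $ i $ j\<bar> \<le> m"
  shows "entrywise_norm p Y powr q \<le> (real CARD('n) * real CARD('r)) powr (q / p) * m powr q"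
proof -
  have "entrywise_norm p Y powr q \<le> ((real CARD('n) * real CARD('r)) powr (1 / p) * m) powr q"
    using entrywise_norm_le[OF assms(1) bound] assms(2)
    by (intro powr_mono2) (auto simp: entrywise_norm_def)
  also have "\<dots> = (real CARD('n) * real CARD('r)) powr (q / p) * m powr q"
    by (subst powr_mult) (auto simp: powr_powr)
  finally show ?thesis .
qed

lemma penalty_le:
  fixes Y :: "real ^ 'r::finite ^ 'n::finite"
  assumes "1 \<le> p" "0 < q1" "0 < q2"
    and "0 \<le> m1" "\<And>i j. - m1 \<le> Y $ i $ j"
    and "\<And>j l. \<bar>(transpose Y ** Y - mat 1) $ j $ l\<bar> \<le> m2"
  shows "penalty p q1 q2 Y \<le>
    (real CARD('n) * real CARD('r)) powr (q1 / p) * m1 powr q1 +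
    (real CARD('r) * real CARD('r)) powr (q2 / p) * m2 powr q2"
proof -
  have "\<bar>neg_part Y $ i $ j\<bar> \<le> m1" for i j
    using assms(4) assms(5)[of i j] by (simp add: neg_part_def)
  then show ?thesis
    unfolding penalty_def using assms by (intro add_mono entrywise_norm_powr_le) auto
qed

lemma penalty_nonneg: "0 \<le> penalty p q1 q2 Y"
  by (simp add: penalty_def)

lemma penalty_nonneg_stiefel:
  fixes X :: "real ^ 'r::finite ^ 'n::finite"
  assumes "X \<in> nonneg_stiefel" "1 \<le> p" "0 < q1" "0 < q2"
  shows "penalty p q1 q2 X = 0"
proof -
  have "penalty p q1 q2 X \<le> 0"
    using penalty_le[of p q1 q2 0 X 0] assms by (auto simp: nonneg_stiefel_def)
  then show ?thesis using penalty_nonneg[of p q1 q2 X] by linarith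
qed

section \<open>Lower bounds on the distance to the nonnegative Stiefel manifold\<close>

lemma infdist_ge:
  assumes "A \<noteq> {}" "\<And>z. z \<in> A \<Longrightarrow> d \<le> dist y z"
  shows "d \<le> infdist y A"
  using assms by (auto simp: infdist_notempty intro!: cINF_greatest)

lemma entry_diff_le_dist:
  fixes Y Z :: "real ^ 'r::finite ^ 'n::finite"
  shows "\<bar>Y $ i $ j - Z $ i $ j\<bar> \<le> dist Y Z"
proof -
  have "\<bar>Y $ i $ j - Z $ i $ j\<bar> = \<bar>(Y - Z) $ i $ j\<bar>" by simp
  also have "\<dots> \<le> norm ((Y - Z) $ i)" by (rule component_le_norm_cart)
  also have "\<dots> \<le> norm (Y - Z)" by (rule Finite_Cartesian_Product.norm_nth_le)
  finally show ?thesis by (simp add: dist_norm)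
qed

text \<open>
  Orthogonality of two columns is a vanishing sum of nonnegative products, so each product vanishes.
\<close>

lemma nonneg_stiefel_disjoint_supports:
  fixes Z :: "real ^ 'r::finite ^ 'n::finite"
  assumes "Z \<in> nonneg_stiefel" "a \<noteq> b"
  shows "Z $ k $ a = 0 \<or> Z $ k $ b = 0"
proof -
  have "(\<Sum>i\<in>UNIV. Z $ i $ a * Z $ i $ b) = (mat 1 :: real ^ 'r ^ 'r) $ a $ b"
    using assms(1) by (simp add: nonneg_stiefel_def flip: gram_entry)
  also have "\<dots> = 0" using assms(2) by (simp add: mat_def)
  finally have "\<forall>i\<in>UNIV. Z $ i $ a * Z $ i $ b = 0"
    using assms(1) by (subst (asm) sum_nonneg_eq_0_iff) (auto simp: nonneg_stiefel_def)
  then show ?thesis by auto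
qed

lemma nonneg_stiefel_entry_le_1:
  fixes Z :: "real ^ 'r::finite ^ 'n::finite"
  assumes "Z \<in> nonneg_stiefel"
  shows "Z $ i $ j \<le> 1"
proof -
  have "(Z $ i $ j)\<^sup>2 \<le> (\<Sum>i\<in>UNIV. (Z $ i $ j)\<^sup>2)"
    by (rule member_le_sum) auto
  also have "\<dots> = (mat 1 :: real ^ 'r ^ 'r) $ j $ j"
    using assms by (simp add: nonneg_stiefel_def power2_eq_square flip: gram_entry)
  finally have "(Z $ i $ j)\<^sup>2 \<le> 1\<^sup>2" by (simp add: mat_def)
  then show ?thesis by (rule power2_le_imp_le) simp
qed

lemma two_entries_infdist_lower:
  fixes Y :: "real ^ 'r::finite ^ 'n::finite"
  assumes "nonneg_stiefel \<noteq> ({} :: (real ^ 'r ^ 'n) set)" "a \<noteq> b"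
    and "d \<le> \<bar>Y $ k $ a\<bar>" "d \<le> \<bar>Y $ k $ b\<bar>"
  shows "d \<le> infdist Y nonneg_stiefel"
proof (rule infdist_ge[OF assms(1)])
  fix Z :: "real ^ 'r ^ 'n" assume "Z \<in> nonneg_stiefel"
  from nonneg_stiefel_disjoint_supports[OF this assms(2), of k]
  show "d \<le> dist Y Z"
    using entry_diff_le_dist[of Y k a Z] entry_diff_le_dist[of Y k b Z] assms(3,4) by auto
qed

section \<open>Perturbed partial permutation matrices\<close>

text \<open>
  For an injection \<open>g\<close> and a row \<open>k\<close> outside its range, column \<open>j\<close> is a multiple of the unit vector
  with index \<open>g j\<close>, perturbed by \<open>\<beta> j\<close> in the spare row \<open>k\<close> and by \<open>- \<gamma> j\<close> in the row \<open>g a\<close>, the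
  main row of the distinguished column \<open>a\<close>.  Both violating families near the manifold and their
  common limit have this shape, so that one Gram matrix computation serves all of them.
\<close>

definition perturbed_frame ::
    "('r \<Rightarrow> 'n) \<Rightarrow> 'n \<Rightarrow> 'r \<Rightarrow> ('r \<Rightarrow> real) \<Rightarrow> ('r \<Rightarrow> real) \<Rightarrow> ('r \<Rightarrow> real) \<Rightarrow> real ^ 'r ^ 'n" where
  "perturbed_frame g k a \<alpha> \<beta> \<gamma> =
     (\<chi> i j. (if i = g j then \<alpha> j else 0) + (if i = k then \<beta> j else 0) - (if i = g a then \<gamma> j else 0))"

lemma gram_perturbed_frame:
  fixes g :: "'r::finite \<Rightarrow> 'n::finite" and \<alpha> \<beta> \<gamma> :: "'r \<Rightarrow> real" and a :: 'r
  assumes "inj g" "k \<notin> range g"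
  defines "Y \<equiv> perturbed_frame g k a \<alpha> \<beta> \<gamma>"
  shows "(transpose Y ** Y) $ j $ l =
    (if j = l then \<alpha> j * \<alpha> j else 0) + \<beta> j * \<beta> l + \<gamma> j * \<gamma> l
    - (if j = a then \<alpha> a * \<gamma> l else 0) - (if l = a then \<gamma> j * \<alpha> a else 0)"
proof -
  have k: "k \<noteq> g x" "g x \<noteq> k" for x using assms(2) by auto
  have g: "g x = g y \<longleftrightarrow> x = y" for x y using assms(1) by (auto dest: injD)
  have "(transpose Y ** Y) $ j $ l = (\<Sum>i\<in>UNIV.
      (if i = g j then (if j = l then \<alpha> j * \<alpha> j else 0) else 0)
      + (if i = k then \<beta> j * \<beta> l else 0) + (if i = g a then \<gamma> j * \<gamma> l else 0)
      - (if i = g a then (if j = a then \<alpha> a * \<gamma> l else 0) else 0)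
      - (if i = g a then (if l = a then \<gamma> j * \<alpha> a else 0) else 0))"
    unfolding gram_entry Y_def perturbed_frame_def
    by (intro sum.cong) (auto simp: k g algebra_simps)
  also have "\<dots> = (if j = l then \<alpha> j * \<alpha> j else 0) + \<beta> j * \<beta> l + \<gamma> j * \<gamma> l
    - (if j = a then \<alpha> a * \<gamma> l else 0) - (if l = a then \<gamma> j * \<alpha> a else 0)"
    by (simp add: sum.distrib sum_subtractf)
  finally show ?thesis .
qed

lemma frame_in_nonneg_stiefel:
  fixes g :: "'r::finite \<Rightarrow> 'n::finite"
  assumes "inj g" "k \<notin> range g"
  shows "perturbed_frame g k a (\<lambda>_. 1) (\<lambda>_. 0) (\<lambda>_. 0) \<in> nonneg_stiefel"
  unfolding nonneg_stiefel_def
  by (auto simp: vec_eq_iff gram_perturbed_frame[OF assms] mat_def)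
     (auto simp: perturbed_frame_def)

lemma tendsto_perturbed_frame:
  assumes "\<And>j. ((\<lambda>t. \<alpha> t j) \<longlongrightarrow> \<alpha>' j) F" "\<And>j. ((\<lambda>t. \<beta> t j) \<longlongrightarrow> \<beta>' j) F" "\<And>j. ((\<lambda>t. \<gamma> t j) \<longlongrightarrow> \<gamma>' j) F"
  shows "((\<lambda>t. perturbed_frame g k a (\<alpha> t) (\<beta> t) (\<gamma> t)) \<longlongrightarrow> perturbed_frame g k a \<alpha>' \<beta>' \<gamma>') F"
  unfolding perturbed_frame_def
  by (intro vec_tendstoI) (auto intro!: tendsto_intros assms)

section \<open>Violating the error bound\<close>

text \<open>
  A penalty of order \<open>\<delta> powr s\<close> with \<open>s > 1\<close> is eventually below any fixed multiple of a distance
  of order \<open>\<delta>\<close>.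
\<close>

lemma error_bound_fails_nearby:
  fixes Y :: "real \<Rightarrow> 'a::metric_space" and \<phi> d :: "'a \<Rightarrow> real"
  assumes lim: "(Y \<longlongrightarrow> X) (at_right 0)"
    and "1 < s" "0 < c"
    and upper: "\<forall>\<^sub>F \<delta> in at_right 0. \<phi> (Y \<delta>) \<le> K * \<delta> powr s"
    and lower: "\<forall>\<^sub>F \<delta> in at_right 0. c * \<delta> \<le> d (Y \<delta>)"
    and "0 < \<mu>" "0 < e"
  shows "\<exists>y\<in>ball X e. \<mu> * \<phi> y < d y"
proof -
  have "((\<lambda>\<delta>. \<mu> * (K * \<delta> powr (s - 1))) \<longlongrightarrow> \<mu> * (K * 0)) (at_right 0)"
    using assms(2)
    by (intro tendsto_intros tendsto_zero_powrI[where b = "s - 1"])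
       (auto intro: tendsto_ident_at eventually_mono[OF eventually_at_right_less])
  then have small: "\<forall>\<^sub>F \<delta> in at_right 0. \<mu> * (K * \<delta> powr (s - 1)) < c"
    using assms(3) by (intro order_tendstoD(2)) auto
  have pos: "\<forall>\<^sub>F \<delta>::real in at_right 0. 0 < \<delta>"
    by (rule eventually_at_right_less)
  have near: "\<forall>\<^sub>F \<delta> in at_right 0. dist (Y \<delta>) X < e"
    using lim assms(7) by (rule tendstoD)
  have "\<forall>\<^sub>F \<delta> in at_right 0. Y \<delta> \<in> ball X e \<and> \<mu> * \<phi> (Y \<delta>) < d (Y \<delta>)"
    using small pos near upper lower
  proof eventually_elim
    case (elim \<delta>)
    have "\<mu> * \<phi> (Y \<delta>) \<le> \<mu> * (K * \<delta> powr s)"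
      using elim assms(6) by (intro mult_left_mono) auto
    also have "\<delta> powr s = \<delta> powr (s - 1) * \<delta>"
      using elim powr_add[of \<delta> "s - 1" 1] by simp
    also have "\<mu> * (K * (\<delta> powr (s - 1) * \<delta>)) = (\<mu> * (K * \<delta> powr (s - 1))) * \<delta>"
      by (simp add: mult_ac)
    also have "\<dots> < c * \<delta>" using elim by (intro mult_strict_right_mono) auto
    also have "\<dots> \<le> d (Y \<delta>)" using elim by simp
    finally show ?case using elim by (simp add: dist_commute)
  qed
  then show ?thesis
    using eventually_happens'[OF trivial_limit_at_right_real] by blast
qed

lemma sq_powr:
  fixes \<delta> :: real
  assumes "0 < \<delta>"
  shows "\<delta>\<^sup>2 powr q = \<delta> powr (2 * q)"
  using assms powr_powr[of \<delta> 2 q] by simp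

text \<open>
  The two entries \<open>\<delta>\<close> in the spare row leave the matrix nonnegative and change the Gram matrix by
  \<open>\<delta>\<^sup>2\<close> only.
\<close>

lemma error_bound_fails_orthogonality:
  fixes g :: "'r::finite \<Rightarrow> 'n::finite"
  assumes g: "inj g" "k \<notin> range g" and "a \<noteq> b"
    and pq: "1 \<le> p" "0 < q1" "1/2 < q2" and "0 < \<mu>" "0 < e"
  shows "\<exists>Y\<in>ball (perturbed_frame g k a (\<lambda>_. 1) (\<lambda>_. 0) (\<lambda>_. 0)) e.
    \<mu> * penalty p q1 q2 Y < infdist Y nonneg_stiefel"
proof -
  define \<beta> :: "real \<Rightarrow> 'r \<Rightarrow> real" where "\<beta> \<delta> j = (if j = a \<or> j = b then \<delta> else 0)" for \<delta> j
  define Y where "Y \<delta> = perturbed_frame g k a (\<lambda>_. 1) (\<beta> \<delta>) (\<lambda>_. 0)" for \<delta>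
  have ne: "nonneg_stiefel \<noteq> ({} :: (real ^ 'r ^ 'n) set)"
    using frame_in_nonneg_stiefel[OF g] by auto
  show ?thesis
  proof (rule error_bound_fails_nearby)
    show "(Y \<longlongrightarrow> perturbed_frame g k a (\<lambda>_. 1) (\<lambda>_. 0) (\<lambda>_. 0)) (at_right 0)"
      unfolding Y_def
    proof (rule tendsto_perturbed_frame)
      fix j
      show "((\<lambda>\<delta>. \<beta> \<delta> j) \<longlongrightarrow> 0) (at_right 0)"
        by (cases "j = a \<or> j = b") (auto simp: \<beta>_def intro: tendsto_ident_at)
    qed auto
    show "\<forall>\<^sub>F \<delta> in at_right 0. penalty p q1 q2 (Y \<delta>)
        \<le> (real CARD('r) * real CARD('r)) powr (q2 / p) * \<delta> powr (2 * q2)"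
      using eventually_at_right_less[of "0::real"]
    proof eventually_elim
      case (elim \<delta>)
      have "\<bar>(transpose (Y \<delta>) ** Y \<delta> - mat 1) $ j $ l\<bar> \<le> \<delta>\<^sup>2" for j l
        by (auto simp: Y_def gram_perturbed_frame[OF g] mat_def \<beta>_def power2_eq_square)
      moreover have "- 0 \<le> Y \<delta> $ i $ j" for i j
        using elim by (auto simp: Y_def perturbed_frame_def \<beta>_def)
      ultimately have "penalty p q1 q2 (Y \<delta>) \<le> (real CARD('n) * real CARD('r)) powr (q1 / p) * 0 powr q1
          + (real CARD('r) * real CARD('r)) powr (q2 / p) * (\<delta>\<^sup>2) powr q2"
        using pq by (intro penalty_le) auto
      then show ?case using elim by (simp add: sq_powr)
    qed
    show "\<forall>\<^sub>F \<delta> in at_right 0. 1 * \<delta> \<le> infdist (Y \<delta>) nonneg_stiefel"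
      using eventually_at_right_less[of "0::real"]
    proof eventually_elim
      case (elim \<delta>)
      have "Y \<delta> $ k $ a = \<delta>" "Y \<delta> $ k $ b = \<delta>"
        using g(2) by (auto simp: Y_def perturbed_frame_def \<beta>_def)
      then show ?case
        using two_entries_infdist_lower[OF ne assms(3), of "\<delta>" "Y \<delta>" k] by simp
    qed
  qed (use assms in auto)
qed

text \<open>
  In the rows \<open>g a\<close>, \<open>k\<close>, \<open>g b\<close> the columns \<open>a\<close> and \<open>b\<close> are the normalizations of the orthogonal
  vectors \<open>(1, \<delta>, 0)\<close> and \<open>(- \<delta>\<^sup>2, \<delta>, 1)\<close>: the entry \<open>- \<delta>\<^sup>2\<close> cancels the product of the two
  entries \<open>\<delta>\<close>, so that the columns are orthonormal and only the nonnegativity is violated.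
\<close>

lemma error_bound_fails_nonnegativity:
  fixes g :: "'r::finite \<Rightarrow> 'n::finite"
  assumes g: "inj g" "k \<notin> range g" and ab: "a \<noteq> b"
    and pq: "1 \<le> p" "1/2 < q1" "0 < q2" and "0 < \<mu>" "0 < e"
  shows "\<exists>Y\<in>ball (perturbed_frame g k a (\<lambda>_. 1) (\<lambda>_. 0) (\<lambda>_. 0)) e.
    \<mu> * penalty p q1 q2 Y < infdist Y nonneg_stiefel"
proof -
  define u :: "real \<Rightarrow> real" where "u \<delta> = 1 / sqrt (1 + \<delta>\<^sup>2)" for \<delta>
  define v :: "real \<Rightarrow> real" where "v \<delta> = 1 / sqrt (1 + \<delta>\<^sup>2 + (\<delta>\<^sup>2)\<^sup>2)" for \<delta>
  define \<alpha> :: "real \<Rightarrow> 'r \<Rightarrow> real"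
    where "\<alpha> \<delta> j = (if j = a then u \<delta> else if j = b then v \<delta> else 1)" for \<delta> j
  define \<beta> :: "real \<Rightarrow> 'r \<Rightarrow> real"
    where "\<beta> \<delta> j = (if j = a then u \<delta> * \<delta> else if j = b then v \<delta> * \<delta> else 0)" for \<delta> j
  define \<gamma> :: "real \<Rightarrow> 'r \<Rightarrow> real" where "\<gamma> \<delta> j = (if j = b then v \<delta> * \<delta>\<^sup>2 else 0)" for \<delta> j
  define Y where "Y \<delta> = perturbed_frame g k a (\<alpha> \<delta>) (\<beta> \<delta>) (\<gamma> \<delta>)" for \<delta>
  have ne: "nonneg_stiefel \<noteq> ({} :: (real ^ 'r ^ 'n) set)"
    using frame_in_nonneg_stiefel[OF g] by auto
  have pos1: "0 < 1 + \<delta>\<^sup>2" and pos2: "0 < 1 + \<delta>\<^sup>2 + (\<delta>\<^sup>2)\<^sup>2" for \<delta> :: real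
    by (intro add_pos_nonneg; simp)+
  have uu: "u \<delta> * u \<delta> * (1 + \<delta>\<^sup>2) = 1" for \<delta>
    using pos1[of \<delta>] by (simp add: u_def)
  have vv: "v \<delta> * v \<delta> * (1 + \<delta>\<^sup>2 + (\<delta>\<^sup>2)\<^sup>2) = 1" for \<delta>
    using pos2[of \<delta>] by (simp add: v_def)
  have uv_pos: "0 < u \<delta>" "0 < v \<delta>" for \<delta>
    using pos1[of \<delta>] pos2[of \<delta>] by (simp_all add: u_def v_def)
  have "1 \<le> sqrt (1 + \<delta>\<^sup>2 + (\<delta>\<^sup>2)\<^sup>2)" for \<delta> :: real
    using zero_le_power2[of \<delta>] zero_le_power2[of "\<delta>\<^sup>2"] by (intro real_sqrt_ge_one) linarith
  then have v_le: "v \<delta> \<le> 1" for \<delta>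
    unfolding v_def using pos2[of \<delta>] by (subst divide_le_eq_1_pos) auto
  have u_lim: "(u \<longlongrightarrow> 1) (at_right 0)"
    unfolding u_def by (rule tendsto_eq_intros refl | simp)+
  have v_lim: "(v \<longlongrightarrow> 1) (at_right 0)"
    unfolding v_def by (rule tendsto_eq_intros refl | simp)+
  have id_lim: "((\<lambda>\<delta>. \<delta>) \<longlongrightarrow> 0) (at_right (0::real))" by (rule tendsto_ident_at)
  show ?thesis
  proof (rule error_bound_fails_nearby)
    show "(Y \<longlongrightarrow> perturbed_frame g k a (\<lambda>_. 1) (\<lambda>_. 0) (\<lambda>_. 0)) (at_right 0)"
      unfolding Y_def
    proof (rule tendsto_perturbed_frame)
      fix j
      show "((\<lambda>\<delta>. \<alpha> \<delta> j) \<longlongrightarrow> 1) (at_right 0)"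
        using u_lim v_lim by (cases "j = a"; cases "j = b") (simp_all add: \<alpha>_def)
      show "((\<lambda>\<delta>. \<beta> \<delta> j) \<longlongrightarrow> 0) (at_right 0)"
        using tendsto_mult[OF u_lim id_lim] tendsto_mult[OF v_lim id_lim]
        by (cases "j = a"; cases "j = b") (simp_all add: \<beta>_def)
      show "((\<lambda>\<delta>. \<gamma> \<delta> j) \<longlongrightarrow> 0) (at_right 0)"
        using tendsto_mult[OF v_lim tendsto_power[OF id_lim, of 2]]
        by (cases "j = b") (simp_all add: \<gamma>_def)
    qed
    show "\<forall>\<^sub>F \<delta> in at_right 0. penalty p q1 q2 (Y \<delta>)
        \<le> (real CARD('n) * real CARD('r)) powr (q1 / p) * \<delta> powr (2 * q1)"
      using eventually_at_right_less[of "0::real"]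
    proof eventually_elim
      case (elim \<delta>)
      have "\<bar>(transpose (Y \<delta>) ** Y \<delta> - mat 1) $ j $ l\<bar> \<le> 0" for j l
        using ab uu[of \<delta>] vv[of \<delta>]
        by (auto simp: Y_def gram_perturbed_frame[OF g] mat_def \<alpha>_def \<beta>_def \<gamma>_def
            algebra_simps power2_eq_square)
      moreover have "- (\<delta>\<^sup>2) \<le> Y \<delta> $ i $ j" for i j
      proof -
        have "\<gamma> \<delta> j \<le> \<delta>\<^sup>2"
          using v_le[of \<delta>] mult_right_mono[of "v \<delta>" 1 "\<delta>\<^sup>2"] by (simp add: \<gamma>_def)
        moreover have "0 \<le> \<alpha> \<delta> j" "0 \<le> \<beta> \<delta> j"
          using elim uv_pos[of \<delta>] by (auto simp: \<alpha>_def \<beta>_def)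
        ultimately show ?thesis
          by (auto simp: Y_def perturbed_frame_def intro: order_trans[of _ 0])
      qed
      ultimately have "penalty p q1 q2 (Y \<delta>)
          \<le> (real CARD('n) * real CARD('r)) powr (q1 / p) * (\<delta>\<^sup>2) powr q1
          + (real CARD('r) * real CARD('r)) powr (q2 / p) * 0 powr q2"
        using pq by (intro penalty_le) auto
      then show ?case using elim by (simp add: sq_powr)
    qed
    \<comment> \<open>Normalization shrinks the two entries \<open>\<delta>\<close>, but by a factor tending to 1.\<close>
    have "\<forall>\<^sub>F \<delta> in at_right 0. 1/2 < u \<delta>" "\<forall>\<^sub>F \<delta> in at_right 0. 1/2 < v \<delta>"
      by (rule order_tendstoD(1)[OF u_lim], simp, rule order_tendstoD(1)[OF v_lim], simp)
    then show "\<forall>\<^sub>F \<delta> in at_right 0. 1/2 * \<delta> \<le> infdist (Y \<delta>) nonneg_stiefel"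
      using eventually_at_right_less[of "0::real"]
    proof eventually_elim
      case (elim \<delta>)
      have "Y \<delta> $ k $ a = u \<delta> * \<delta>" "Y \<delta> $ k $ b = v \<delta> * \<delta>"
        using g(2) ab by (auto simp: Y_def perturbed_frame_def \<beta>_def)
      moreover have "1/2 * \<delta> \<le> u \<delta> * \<delta>" "1/2 * \<delta> \<le> v \<delta> * \<delta>"
        using elim by (auto intro: mult_right_mono)
      ultimately show ?case
        by (intro two_entries_infdist_lower[OF ne ab, where k = k]) auto
    qed
  qed (use assms in auto)
qed

lemma error_bound_fails_at_infinity:
  fixes X :: "real ^ 'r::finite ^ 'n::finite"
  assumes X: "X \<in> nonneg_stiefel" "X $ i $ j = 1"
    and pq: "1 \<le> p" "0 < q1" "0 < q2" "q2 < 1/2" and "0 < \<mu>"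
  shows "\<exists>Y::real ^ 'r ^ 'n. \<mu> * penalty p q1 q2 Y < infdist Y nonneg_stiefel"
proof -
  define K where "K = (real CARD('r) * real CARD('r)) powr (q2 / p)"
  have "((\<lambda>t. \<mu> * (K * t powr (2 * q2 - 1))) \<longlongrightarrow> \<mu> * (K * 0)) at_top"
    using pq by (intro tendsto_intros tendsto_neg_powr filterlim_ident) auto
  then have "\<forall>\<^sub>F t in at_top. \<mu> * (K * t powr (2 * q2 - 1)) < 1/2"
    by (intro order_tendstoD(2)) auto
  moreover have "\<forall>\<^sub>F t::real in at_top. 2 \<le> t" by (rule eventually_ge_at_top)
  ultimately have "\<forall>\<^sub>F t in at_top. \<mu> * (K * t powr (2 * q2 - 1)) < 1/2 \<and> 2 \<le> t"
    by (rule eventually_conj)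
  then obtain t :: real where t: "\<mu> * (K * t powr (2 * q2 - 1)) < 1/2" "2 \<le> t"
    using eventually_happens'[OF trivial_limit_at_top_linorder] by blast
  have gram: "transpose X ** X = mat 1" and nonneg: "\<And>i j. 0 \<le> X $ i $ j"
    using X(1) by (auto simp: nonneg_stiefel_def)
  have "(transpose (t *\<^sub>R X) ** (t *\<^sub>R X)) $ j $ l = t\<^sup>2 * (transpose X ** X) $ j $ l" for j l
    unfolding gram_entry by (simp add: sum_distrib_left power2_eq_square mult_ac)
  moreover have "1 \<le> t\<^sup>2" using t(2) by (simp add: one_le_power)
  ultimately have "\<bar>(transpose (t *\<^sub>R X) ** (t *\<^sub>R X) - mat 1) $ j $ l\<bar> \<le> t\<^sup>2" for j l
    by (auto simp: gram mat_def)
  moreover have "- 0 \<le> (t *\<^sub>R X) $ i $ j" for i j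
    using nonneg t(2) by simp
  ultimately have "penalty p q1 q2 (t *\<^sub>R X)
      \<le> (real CARD('n) * real CARD('r)) powr (q1 / p) * 0 powr q1 + K * (t\<^sup>2) powr q2"
    unfolding K_def using pq by (intro penalty_le) auto
  also have "\<dots> = K * (t powr (2 * q2 - 1) * t)"
    using t(2) powr_add[of t "2 * q2 - 1" 1] by (simp add: sq_powr)
  finally have "\<mu> * penalty p q1 q2 (t *\<^sub>R X) \<le> \<mu> * (K * t powr (2 * q2 - 1)) * t"
    using assms(7) by (simp add: mult_left_mono mult.assoc)
  also have "\<dots> < 1/2 * t" using t by (intro mult_strict_right_mono) auto
  also have "\<dots> \<le> t - 1" using t(2) by simp
  also have "\<dots> \<le> infdist (t *\<^sub>R X) nonneg_stiefel"
  proof (rule infdist_ge)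
    fix Z :: "real ^ 'r ^ 'n" assume "Z \<in> nonneg_stiefel"
    from nonneg_stiefel_entry_le_1[OF this, of i j]
    show "t - 1 \<le> dist (t *\<^sub>R X) Z"
      using entry_diff_le_dist[of "t *\<^sub>R X" i j Z] X(2) by simp
  qed (use X in auto)
  finally show ?thesis by blast
qed

lemma ex_inj_missing:
  assumes "CARD('r::finite) < CARD('n::finite)"
  obtains g :: "'r::finite \<Rightarrow> 'n::finite" and k where "inj g" "k \<notin> range g"
proof -
  obtain g :: "'r \<Rightarrow> 'n" where g: "inj g"
    using card_le_inj[of "UNIV::'r set" "UNIV::'n set"] assms by auto
  then have "card (range g) < CARD('n)" using assms by (simp add: card_image)
  then have "range g \<noteq> UNIV" by auto
  then show ?thesis using that g by blast
qed

section \<open>The counterexample to exact penalization\<close>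

theorem proposition7:
  fixes p q1 q2 :: real
  assumes "1 < CARD('r::finite)" and "CARD('r) < CARD('n::finite)"
    and "1 \<le> p" and "0 < q1" and "0 < q2"
  shows "\<exists>F :: real ^ 'r ^ 'n \<Rightarrow> real.
    (\<exists>L. L-lipschitz_on UNIV F) \<and>
    Argmin F nonneg_stiefel = nonneg_stiefel \<and>
    (q1 > 1/2 \<or> q2 \<noteq> 1/2 \<longrightarrow>
      (\<forall>X\<in>nonneg_stiefel. \<forall>\<mu>>0. X \<notin> Argmin (\<lambda>Y. F Y + \<mu> * penalty p q1 q2 Y) UNIV)) \<and>
    (q1 > 1/2 \<or> q2 > 1/2 \<longrightarrow>
      (\<exists>X\<in>nonneg_stiefel. \<forall>\<mu>>0. \<not> local_minimizer (\<lambda>Y. F Y + \<mu> * penalty p q1 q2 Y) X))"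
proof -
  define S :: "(real ^ 'r ^ 'n) set" where "S = nonneg_stiefel"
  define F where "F Y = - infdist Y S" for Y
  obtain g :: "'r \<Rightarrow> 'n" and k where g: "inj g" "k \<notin> range g"
    using ex_inj_missing[OF assms(2)] .
  obtain a b :: 'r where ab: "a \<noteq> b"
    using assms(1) card_le_Suc0_iff_eq[of "UNIV::'r set"] by auto
  define X0 where "X0 = perturbed_frame g k a (\<lambda>_. 1) (\<lambda>_. 0) (\<lambda>_. 0)"
  have X0: "X0 \<in> S" unfolding X0_def S_def using g by (rule frame_in_nonneg_stiefel)
  have X0_entry: "X0 $ g a $ a = 1" using g(2) by (auto simp: X0_def perturbed_frame_def)
  have on_S: "F X + \<mu> * penalty p q1 q2 X = 0" if "X \<in> S" for X \<mu>
    using that assms(3-5) penalty_nonneg_stiefel[of X p q1 q2] by (simp add: F_def S_def)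
  have near: "\<exists>Y\<in>ball X0 e. \<mu> * penalty p q1 q2 Y < infdist Y S"
    if "q1 > 1/2 \<or> q2 > 1/2" "0 < \<mu>" "0 < e" for \<mu> e
    using error_bound_fails_nonnegativity[OF g ab, of p q1 q2 \<mu> e]
      error_bound_fails_orthogonality[OF g ab, of p q1 q2 \<mu> e] that assms(3-5)
    unfolding X0_def S_def by blast
  have somewhere: "\<exists>Y. \<mu> * penalty p q1 q2 Y < infdist Y S"
    if "q1 > 1/2 \<or> q2 \<noteq> 1/2" "0 < \<mu>" for \<mu>
  proof (cases "q1 > 1/2 \<or> q2 > 1/2")
    case True
    then show ?thesis using near[of \<mu> 1] that by auto
  next
    case False
    then show ?thesis
      using error_bound_fails_at_infinity[of X0 "g a" a p q1 q2 \<mu>] X0 X0_entry that assms(3-5)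
      unfolding S_def by auto
  qed
  have "1-lipschitz_on UNIV F"
  proof (rule lipschitz_onI)
    fix Y Z :: "real ^ 'r ^ 'n"
    show "dist (F Y) (F Z) \<le> 1 * dist Y Z"
      using infdist_triangle_abs[of Y S Z] by (simp add: F_def dist_real_def)
  qed simp
  moreover have "Argmin F S = S"
    by (auto simp: Argmin_def is_arg_min_def F_def)
  moreover have "X \<notin> Argmin (\<lambda>Y. F Y + \<mu> * penalty p q1 q2 Y) UNIV"
    if cond: "q1 > 1/2 \<or> q2 \<noteq> 1/2" and XS: "X \<in> S" and mu: "0 < \<mu>" for X \<mu>
  proof -
    obtain Y where "\<mu> * penalty p q1 q2 Y < infdist Y S" using somewhere[OF cond mu] by auto
    then have "F Y + \<mu> * penalty p q1 q2 Y < F X + \<mu> * penalty p q1 q2 X"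
      unfolding on_S[OF XS] by (simp add: F_def)
    then show ?thesis by (auto simp: Argmin_def is_arg_min_def)
  qed
  moreover have "\<not> local_minimizer (\<lambda>Y. F Y + \<mu> * penalty p q1 q2 Y) X0"
    if cond: "q1 > 1/2 \<or> q2 > 1/2" and mu: "0 < \<mu>" for \<mu>
    unfolding local_minimizer_def
  proof clarify
    fix e :: real
    assume e: "0 < e" and min: "X0 \<in> Argmin (\<lambda>Y. F Y + \<mu> * penalty p q1 q2 Y) (ball X0 e)"
    obtain Y where Y: "Y \<in> ball X0 e" "\<mu> * penalty p q1 q2 Y < infdist Y S"
      using near[OF cond mu e] by auto
    then have "F Y + \<mu> * penalty p q1 q2 Y < F X0 + \<mu> * penalty p q1 q2 X0"
      unfolding on_S[OF X0] by (simp add: F_def)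
    then show False using min Y(1) by (auto simp: Argmin_def is_arg_min_def)
  qed
  ultimately show ?thesis
    unfolding S_def[symmetric] using X0 by blast
qed

end
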